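(* Let $0\le\mathsf r<\sum_{i=1}^N\pi_i(1-q_i)$ and consider the convex optimization problem $$\min\ \sum_{i=1}^N\pi_i\,\breve s_i(r_i)\quad\text{subject to}\quad \sum_{i=1}^N\pi_i r_i=\mathsf r,\qquad r_i\in[0,1-q_i],\ i=1,\dots,N,$$ where $\breve s_i$ is the optimal rate-cost function of content class $i$. The optimal solution is given by $$r_i^*(\beta)=\begin{cases}1-q_i & \text{if } \breve s_i'(1-q_i)\le\beta,\\ \varsigma_i(\beta)&\text{otherwise},\end{cases}$$ where $\varsigma_i$ is the inverse function of the derivative $\breve s_i'$, i.e. $\breve s_i'(\varsigma_i(\beta))=\beta$, and $\beta$ is a positive number satisfying $\sum_{i=1}^N\pi_i r_i^*(\beta)=\mathsf r$. (If $\breve s_i'$ is not invertible, $r_i$ can be any solution that satisfies $\breve s_i'(r_i)=\beta$ and $\sum_{i=1}^N\pi_i r_i(\beta)=\mathsf r$.)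
   Context: There are $N$ classes of content items, and a user with an infinite buffer. $\pi_i$ is the probability that a bit belongs to class $i$. A class-$i$ item is requested after a random delay with probability density function $p_i$ (possibly containing delta atoms) and cumulative distribution function $P_i$; the delay is $-\infty$ if the item is never requested, which has probability $q_i=P_i(0)$. Put $P_i^{-1}(z)=\inf\{x:P_i(x)\ge z\}$. The normalized rate-cost function of class $i$ under static caching is $$s_i(r)=\int_0^{P_i^{-1}(r+q_i)}x\,dP_i(x)+(1-r)\,P_i^{-1}(r+q_i),\qquad r\in(0,1-q_i],$$ where $r$ is the hit ratio and $s_i(r)$ the mean caching time (normalized storage cost). The optimal rate-cost function $\breve s_i$, attained by randomizing the maximum caching time, is the lower convex envelope of $s_i$ together with the value $0$ at $r=0$, i.e. the supremum of all convex functions $s_e$ with $s_e(0)=0$ and $s_e(r)\le s_i(r)$ for $r\in(0,1-q_i]$. $\breve s_i'$ denotes its derivative. $\sum_i\pi_ir_i$ and $\sum_i\pi_i\breve s_i(r_i)$ are the normalized effective throughput and the normalized storage cost, and $\mathsf r$ is the target normalized effective throughput.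
   Formalization: Formalized with rate 0 for classes whose initial slope exceeds β, one-sided derivatives at kinks, β ≥ 0 instead of β > 0 if the target is 0 and some initial slope is 0, and uniqueness of form only for classes with π_i > 0; the formula as stated fails in these cases. *)

theory Defs
  imports "HOL-Probability.Probability"
begin

(* A request delay is an ereal: -\<infinity> means "never requested", so the distribution may have
   any mix of density and atoms on the nonnegative reals. The last conjunct is q = P(0), i.e.
   there is no atom at delay 0. *)
definition never_prob :: "ereal measure \<Rightarrow> real" where
  "never_prob M = measure M {-\<infinity>}"

definition delay_cdf :: "ereal measure \<Rightarrow> ereal \<Rightarrow> real" where
  "delay_cdf M x = measure M {..x}"

definition delay_distribution :: "ereal measure \<Rightarrow> bool" where
  "delay_distribution M \<longleftrightarrow>
     prob_space M \<and> sets M = sets borel \<and>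
     (AE x in M. x = -\<infinity> \<or> (0 \<le> x \<and> x < \<infinity>)) \<and>
     never_prob M = delay_cdf M 0"

(* The value is \<infinity> for z = 1 and a delay of unbounded support. *)
definition delay_quantile :: "ereal measure \<Rightarrow> real \<Rightarrow> ereal" where
  "delay_quantile M z = Inf {x. z \<le> delay_cdf M x}"

(* Only used for 0 < r \<le> 1 - q. The value can be \<infinity>, but only at r = 1 - q;
   ereal multiplication has 0 * \<infinity> = 0, which is relevant when r = 1 and q = 0. *)
definition static_cost :: "ereal measure \<Rightarrow> real \<Rightarrow> ereal" where
  "static_cost M r =
     (let T = delay_quantile M (r + never_prob M)
      in enn2ereal (\<integral>\<^sup>+x\<in>{0..T}. e2ennreal x \<partial>M) + ereal (1 - r) * T)"

(* Only meaningful on [0, 1 - q]. *)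
definition opt_cost :: "ereal measure \<Rightarrow> real \<Rightarrow> ereal" where
  "opt_cost M r =
     (SUP s \<in> {s :: real \<Rightarrow> real. convex_on {0..1 - never_prob M} s \<and> s 0 = 0 \<and>
                 (\<forall>x\<in>{0<..1 - never_prob M}. ereal (s x) \<le> static_cost M x)}. ereal (s r))"

definition left_deriv :: "(real \<Rightarrow> ereal) \<Rightarrow> real \<Rightarrow> ereal" where
  "left_deriv f x = Lim (at_left x) (\<lambda>y. (f x - f y) / ereal (x - y))"

definition right_deriv :: "(real \<Rightarrow> ereal) \<Rightarrow> real \<Rightarrow> ereal" where
  "right_deriv f x = Lim (at_right x) (\<lambda>y. (f y - f x) / ereal (y - x))"

(* f'(x) = \<beta> for a convex f on [0, b] that may have kinks: at a kink every slope between the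
   one-sided derivatives is admitted, at 0 every \<beta> up to the right derivative, and at b every
   \<beta> from the left derivative on. Where f is differentiable this is the usual derivative, see
   has_slope_iff_deriv below. *)
definition has_slope :: "(real \<Rightarrow> ereal) \<Rightarrow> real \<Rightarrow> real \<Rightarrow> real \<Rightarrow> bool" where
  "has_slope f b x \<beta> \<longleftrightarrow> 0 \<le> x \<and> x \<le> b \<and>
     (0 < x \<longrightarrow> left_deriv f x \<le> ereal \<beta>) \<and> (x < b \<longrightarrow> ereal \<beta> \<le> right_deriv f x)"

lemma one_sided_deriv_eq_deriv:
  fixes f :: "real \<Rightarrow> ereal" and g :: "real \<Rightarrow> real"
  assumes eq: "\<forall>\<^sub>F y in nhds x. f y = ereal (g y)"
    and der: "(g has_real_derivative D) (at x)"
  shows "left_deriv f x = ereal D" "right_deriv f x = ereal D"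
proof -
  have fx: "f x = ereal (g x)"
    using eq by (rule eventually_nhds_x_imp_x)
  have ev: "\<forall>\<^sub>F y in at x within S. f y = ereal (g y)" for S
    using eq by (auto simp: eventually_at_filter elim: eventually_mono)
  have lim: "((\<lambda>y. (g y - g x) / (y - x)) \<longlongrightarrow> D) (at x within S)" for S
    using has_field_derivative_at_within[OF der, of S] by (simp add: has_field_derivative_iff)
  have "((\<lambda>y. (f x - f y) / ereal (x - y)) \<longlongrightarrow> ereal D) (at_left x)"
  proof (rule Lim_transform_eventually[OF tendsto_ereal[OF lim]])
    show "\<forall>\<^sub>F y in at_left x. ereal ((g y - g x) / (y - x)) = (f x - f y) / ereal (x - y)"
      using ev[of "{..<x}"] eventually_at_left_real[of "x - 1" x, simplified]
    proof eventually_elim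
      case (elim y)
      then show ?case
        using minus_divide_divide[of "g x - g y" "x - y"] by (simp add: fx)
    qed
  qed
  then show "left_deriv f x = ereal D"
    unfolding left_deriv_def by (intro tendsto_Lim) auto
  have "((\<lambda>y. (f y - f x) / ereal (y - x)) \<longlongrightarrow> ereal D) (at_right x)"
  proof (rule Lim_transform_eventually[OF tendsto_ereal[OF lim]])
    show "\<forall>\<^sub>F y in at_right x. ereal ((g y - g x) / (y - x)) = (f y - f x) / ereal (y - x)"
      using ev[of "{x<..}"] eventually_at_right_less[of x]
      by eventually_elim (simp add: fx)
  qed
  then show "right_deriv f x = ereal D"
    unfolding right_deriv_def by (intro tendsto_Lim) auto
qed

lemma has_slope_iff_deriv:
  fixes f :: "real \<Rightarrow> ereal" and g :: "real \<Rightarrow> real"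
  assumes "0 < x" "x < b" "\<forall>\<^sub>F y in nhds x. f y = ereal (g y)"
    and "(g has_real_derivative D) (at x)"
  shows "has_slope f b x \<beta> \<longleftrightarrow> D = \<beta>"
  using assms one_sided_deriv_eq_deriv[OF assms(3,4)] by (auto simp: has_slope_def)

(* x is a value of r*(\<beta>) for one class. When the left derivative at 1 - q equals \<beta> and the
   cost is linear below 1 - q, both disjuncts apply with different x; this is the non-invertible
   case, in which any x with slope \<beta> is allowed. *)
definition rate_at :: "ereal measure \<Rightarrow> real \<Rightarrow> real \<Rightarrow> bool" where
  "rate_at M \<beta> x \<longleftrightarrow>
     (x = 1 - never_prob M \<and> left_deriv (opt_cost M) (1 - never_prob M) \<le> ereal \<beta>) \<or>
     has_slope (opt_cost M) (1 - never_prob M) x \<beta>"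

definition feasible ::
    "nat \<Rightarrow> (nat \<Rightarrow> real) \<Rightarrow> (nat \<Rightarrow> ereal measure) \<Rightarrow> real \<Rightarrow> (nat \<Rightarrow> real) \<Rightarrow> bool" where
  "feasible N \<pi> M \<rho> r \<longleftrightarrow>
     (\<Sum>i=1..N. \<pi> i * r i) = \<rho> \<and> (\<forall>i\<in>{1..N}. r i \<in> {0..1 - never_prob (M i)})"

definition storage_cost ::
    "nat \<Rightarrow> (nat \<Rightarrow> real) \<Rightarrow> (nat \<Rightarrow> ereal measure) \<Rightarrow> (nat \<Rightarrow> real) \<Rightarrow> ereal" where
  "storage_cost N \<pi> M r = (\<Sum>i=1..N. ereal (\<pi> i) * opt_cost (M i) (r i))"

definition optimal_rates ::
    "nat \<Rightarrow> (nat \<Rightarrow> real) \<Rightarrow> (nat \<Rightarrow> ereal measure) \<Rightarrow> real \<Rightarrow> (nat \<Rightarrow> real) \<Rightarrow> bool" where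
  "optimal_rates N \<pi> M \<rho> r \<longleftrightarrow> is_arg_min (storage_cost N \<pi> M) (feasible N \<pi> M \<rho>) r"

end

theory Submission
  imports Defs
begin

text \<open>A rate has slope \<open>\<beta>\<close> exactly when \<open>\<beta>\<close> is a subgradient there, and summing the subgradient
  inequalities of the classes over a fixed total rate shows that a common slope is sufficient and
  necessary for optimality. A common slope exists because each optimal cost is a continuous
  function into the extended reals on the closed interval: the only delicate point is the right
  endpoint, where the static cost is lower semicontinuous from the left and piecewise linear
  minorants carry this over to the envelope. The same minorants make the envelope positive away
  from \<open>0\<close>, hence \<open>\<beta> > 0\<close> whenever the target rate is positive.\<close>

section \<open>Subgradients of convex costs\<close>

text \<open>A convex function on a closed interval may jump upward at an endpoint; the tilted cost
  \<open>f y - \<beta> * y\<close> can then approach an infimum that no rate attains, leaving no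
  rate of slope \<beta>. At 0 the value 0 of a nonnegative cost excludes this; at
  \<open>1 - q\<close> it has to be extracted from the delay distribution. The value there may be
  infinite, so costs stay in \<open>ereal\<close>; comparison with the point 0, where the cost is 0,
  shows that a subgradient exists only where the cost is finite. Subgradients treat kinks, linear
  pieces and endpoints by one inequality, without any inverse of the derivative.\<close>

definition subgradient :: "(real \<Rightarrow> ereal) \<Rightarrow> real \<Rightarrow> real \<Rightarrow> real \<Rightarrow> bool" where
  "subgradient f b x \<beta> \<longleftrightarrow> x \<in> {0..b} \<and> (\<forall>y\<in>{0..b}. f x + ereal (\<beta> * (y - x)) \<le> f y)"

text \<open>Convexity gives continuity inside and, with the value 0 at 0, an upper bound at the
  right end; \<open>lsc_end\<close> supplies the lower bound there. Only the value at
  \<open>b\<close> may be infinite.\<close>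

locale convex_cost =
  fixes f :: "real \<Rightarrow> ereal" and b :: real
  assumes b_nonneg: "0 \<le> b"
    and zero: "f 0 = 0"
    and nonneg: "\<And>x. 0 \<le> x \<Longrightarrow> x \<le> b \<Longrightarrow> 0 \<le> f x"
    and less_infinity: "\<And>x. 0 \<le> x \<Longrightarrow> x < b \<Longrightarrow> f x < \<infinity>"
    and convex: "\<And>x y t. \<lbrakk>0 \<le> x; x \<le> b; 0 \<le> y; y \<le> b; 0 \<le> t; t \<le> 1\<rbrakk> \<Longrightarrow>
      f ((1 - t) * x + t * y) \<le> ereal (1 - t) * f x + ereal t * f y"
    and lsc_end: "\<And>K. 0 < b \<Longrightarrow> ereal K < f b \<Longrightarrow> \<forall>\<^sub>F y in at_left b. ereal K < f y"
begin

lemma real_cost: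
  assumes "0 \<le> x" "x < b"
  shows "\<exists>u\<ge>0. f x = ereal u"
  using nonneg[of x] less_infinity[of x] assms by (cases "f x") auto

section \<open>Chords and monotonicity\<close>

lemma three_point:
  assumes "0 \<le> x" "x < y" "y < z" "z \<le> b"
    and "f x = ereal u" "f y = ereal v" "f z = ereal w"
  shows "(z - x) * v \<le> (z - y) * u + (y - x) * w"
proof -
  define t where "t = (y - x) / (z - x)"
  have t: "0 \<le> t" "t \<le> 1" "t * (z - x) = y - x"
    using assms(1-4) by (simp_all add: t_def)
  have "(1 - t) * x + t * z = x + t * (z - x)"
    by (simp add: algebra_simps)
  also have "\<dots> = y"
    by (simp add: t)
  finally have y: "(1 - t) * x + t * z = y" .
  have "0 \<le> z" "x \<le> b"
    using assms(1-4) by auto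
  then have "ereal v \<le> ereal (1 - t) * ereal u + ereal t * ereal w"
    using convex[of x z t, unfolded y assms(5-7)] assms(1,4) t(1,2) by blast
  then have "v \<le> (1 - t) * u + t * w"
    by simp
  then have "(z - x) * v \<le> (z - x) * ((1 - t) * u + t * w)"
    using assms(2,3) by (intro mult_left_mono) auto
  also have "\<dots> = ((z - x) - t * (z - x)) * u + (t * (z - x)) * w"
    by (simp add: algebra_simps)
  finally show ?thesis
    by (simp add: t)
qed

text \<open>The chord from the origin gives \<open>y * f x \<le> x * f y\<close>; nonnegativity and
  \<open>x \<le> y\<close> do the rest.\<close>

lemma mono:
  assumes "0 \<le> x" "x \<le> y" "y \<le> b"
  shows "f x \<le> f y"
proof (cases "x = 0 \<or> x = y \<or> f y = \<infinity>")
  case True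
  then show ?thesis
    using assms nonneg[of y] zero by auto
next
  case False
  then obtain u v where uv: "f x = ereal u" "f y = ereal v" "0 \<le> u" "0 \<le> v"
    using assms nonneg[of y] real_cost[of x] by (cases "f y") auto
  have "y * u \<le> x * v"
    using three_point[of 0 x y 0 u v] False assms uv zero by auto
  also have "\<dots> \<le> y * v"
    using assms uv by (intro mult_right_mono) auto
  finally show ?thesis
    using False assms uv by simp
qed

section \<open>One-sided derivatives and subgradients\<close>

text \<open>Chord slopes from \<open>x\<close> increase with the far endpoint, so their limit is
  their infimum. The limit is first taken within \<open>{..b}\<close> because nothing is known of
  \<open>f\<close> beyond \<open>b\<close>.\<close>

lemma right_deriv_eq:
  assumes "0 \<le> x" "x < b"
  shows "right_deriv f x = (INF y\<in>{x<..b}. (f y - f x) / ereal (y - x))"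
proof -
  obtain u where u: "f x = ereal u"
    using real_cost assms by metis
  have "((\<lambda>y. (f y - f x) / ereal (y - x)) \<longlongrightarrow>
      Inf ((\<lambda>y. (f y - f x) / ereal (y - x)) ` ({x<..} \<inter> {..b}))) (at x within ({x<..} \<inter> {..b}))"
  proof (rule Lim_right_bound[where K = "-\<infinity>"])
    fix y z assume yz: "y \<in> {..b}" "z \<in> {..b}" "x < y" "y \<le> z"
    show "(f y - f x) / ereal (y - x) \<le> (f z - f x) / ereal (z - x)"
    proof (cases "y = z \<or> f z = \<infinity>")
      case True
      then show ?thesis using yz u by auto
    next
      case False
      then obtain v w where vw: "f y = ereal v" "f z = ereal w"
        using yz assms nonneg[of z] real_cost[of y] by (cases "f z") auto
      have "(z - x) * v \<le> (z - y) * u + (y - x) * w"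
        using three_point[of x y z u v w] False yz assms u vw by auto
      then have "(v - u) * (z - x) \<le> (w - u) * (y - x)"
        by (simp add: algebra_simps)
      then show ?thesis
        using yz by (simp add: u vw pos_divide_le_eq pos_le_divide_eq field_simps)
    qed
  qed simp
  moreover have "at x within ({x<..} \<inter> {..b}) = at_right x"
    using assms by (intro at_within_nhd[of _ "{..<b}"]) auto
  moreover have "{x<..} \<inter> {..b} = {x<..b}"
    by auto
  ultimately show ?thesis
    unfolding right_deriv_def by (intro tendsto_Lim) auto
qed

text \<open>Here \<open>x = b\<close> is allowed: if \<open>f b\<close> is infinite, all the
  quotients are infinite and so is the derivative.\<close>

lemma left_deriv_eq:
  assumes "0 < x" "x \<le> b"
  shows "left_deriv f x = (SUP y\<in>{0..<x}. (f x - f y) / ereal (x - y))"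
proof -
  have "((\<lambda>y. (f x - f y) / ereal (x - y)) \<longlongrightarrow>
      Sup ((\<lambda>y. (f x - f y) / ereal (x - y)) ` ({..<x} \<inter> {0..}))) (at x within ({..<x} \<inter> {0..}))"
  proof (rule Lim_left_bound[where K = "\<infinity>"])
    fix y z :: real assume yz: "y \<in> {0..}" "z \<in> {0..}" "z < x" "y \<le> z"
    obtain u v where uv: "f y = ereal u" "f z = ereal v"
      using yz assms real_cost[of y] real_cost[of z] by auto
    show "(f x - f y) / ereal (x - y) \<le> (f x - f z) / ereal (x - z)"
    proof (cases "y = z \<or> f x = \<infinity>")
      case True
      then show ?thesis using yz uv by auto
    next
      case False
      then obtain w where w: "f x = ereal w"
        using assms nonneg[of x] by (cases "f x") auto
      have "(x - y) * v \<le> (x - z) * u + (z - y) * w"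
        using three_point[of y z x u v w] False yz assms uv w by auto
      then have "(w - u) * (x - z) \<le> (w - v) * (x - y)"
        by (simp add: algebra_simps)
      then show ?thesis
        using yz by (simp add: uv w pos_divide_le_eq pos_le_divide_eq field_simps)
    qed
  qed simp
  moreover have "at x within ({..<x} \<inter> {0..}) = at_left x"
    using assms by (intro at_within_nhd[of _ "{0<..}"]) auto
  moreover have "{..<x} \<inter> {0..} = {0..<x}"
    by auto
  ultimately show ?thesis
    unfolding left_deriv_def by (intro tendsto_Lim) auto
qed

text \<open>The inequality at \<open>y = 0\<close> bounds \<open>f x\<close> by
  \<open>\<beta> * x\<close>, which excludes an infinite endpoint value.\<close>

lemma subgradient_finite:
  assumes "subgradient f b x \<beta>"
  obtains u where "0 \<le> x" "x \<le> b" "0 \<le> u" "f x = ereal u"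
  using assms nonneg[of x] zero b_nonneg
  by (cases "f x") (auto simp: subgradient_def dest!: bspec[of _ _ 0])

lemma subgradientD:
  assumes "subgradient f b x \<beta>" "f x = ereal u" "0 \<le> y" "y \<le> b" "f y = ereal v"
  shows "u + \<beta> * (y - x) \<le> v"
  using assms by (force simp: subgradient_def)

text \<open>The left derivative is a supremum of chord slopes, so bounding it by \<beta> bounds
  every chord to the left, and each such bound is the subgradient inequality at one point; dually to
  the right.\<close>

lemma has_slope_iff_subgradient: "has_slope f b x \<beta> \<longleftrightarrow> subgradient f b x \<beta>"
proof (cases "0 \<le> x \<and> x \<le> b")
  case x: True
  have L: "left_deriv f x \<le> ereal \<beta> \<longleftrightarrow> (\<forall>y\<in>{0..<x}. f x + ereal (\<beta> * (y - x)) \<le> f y)"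
    if "0 < x"
  proof -
    have "(f x - f y) / ereal (x - y) \<le> ereal \<beta> \<longleftrightarrow> f x + ereal (\<beta> * (y - x)) \<le> f y"
      if y: "y \<in> {0..<x}" for y
    proof -
      obtain u where u: "f y = ereal u"
        using y x real_cost[of y] by auto
      show ?thesis
        using y x nonneg[of x] u by (cases "f x") (auto simp: field_simps)
    qed
    then show ?thesis
      using that x by (auto simp: left_deriv_eq SUP_le_iff)
  qed
  have R: "ereal \<beta> \<le> right_deriv f x \<longleftrightarrow> (\<forall>y\<in>{x<..b}. f x + ereal (\<beta> * (y - x)) \<le> f y)"
    if xb: "x < b"
  proof -
    obtain u where u: "f x = ereal u"
      using xb x real_cost[of x] by auto
    have "ereal \<beta> \<le> (f y - f x) / ereal (y - x) \<longleftrightarrow> f x + ereal (\<beta> * (y - x)) \<le> f y"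
      if y: "y \<in> {x<..b}" for y
      using y x nonneg[of y] u by (cases "f y") (auto simp: field_simps)
    then show ?thesis
      using xb x by (auto simp: right_deriv_eq le_INF_iff)
  qed
  have "{0..b} = {0..<x} \<union> {x} \<union> {x<..b}"
    using x by auto
  then have "subgradient f b x \<beta> \<longleftrightarrow>
      (\<forall>y\<in>{0..<x}. f x + ereal (\<beta> * (y - x)) \<le> f y) \<and>
      (\<forall>y\<in>{x<..b}. f x + ereal (\<beta> * (y - x)) \<le> f y)"
    using x by (auto simp: subgradient_def)
  moreover have "{0..<x} = {}" if "\<not> 0 < x" using that by auto
  moreover have "{x<..b} = {}" if "\<not> x < b" using that by auto
  ultimately show ?thesis
    using x L R by (auto simp: has_slope_def)
qed (auto simp: has_slope_def subgradient_def)

section \<open>Continuity and the points of a given slope\<close>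

lemma continuous: "continuous_on {0..b} f"
proof (cases "b = 0")
  case False
  then have b: "0 < b"
    using b_nonneg by simp
  define g where "g = (\<lambda>x. real_of_ereal (f x))"
  have fg: "f x = ereal (g x)" if "0 \<le> x" "x < b" for x
    using real_cost[OF that] by (metis g_def real_of_ereal.simps(1))
  have "convex_on {0<..<b} g"
  proof (rule convex_on_linorderI)
    fix t x y :: real
    assume t: "0 < t" "t < 1" and xy: "x \<in> {0<..<b}" "y \<in> {0<..<b}" "x < y"
    have "(1 - t) * x + t * y \<in> {0<..<b}"
      using convexD[OF convex_real_interval(8)[of 0 b] xy(1,2), of "1 - t" t] t by simp
    then show "g ((1 - t) *\<^sub>R x + t *\<^sub>R y) \<le> (1 - t) * g x + t * g y"
      using convex[of x y t] t xy by (simp add: fg)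
  qed simp
  then have "continuous_on {0<..<b} g"
    by (intro convex_on_continuous) auto
  then have inner: "(f \<longlongrightarrow> f x) (at x within {0..b})" if x: "0 < x" "x < b" for x
  proof -
    have "(g \<longlongrightarrow> g x) (at x)"
      using \<open>continuous_on {0<..<b} g\<close> x
      by (metis continuous_on_eq_continuous_at greaterThanLessThan_iff isCont_def
          open_greaterThanLessThan)
    moreover have "\<forall>\<^sub>F y in at x. f y = ereal (g y)"
      using eventually_at_in_open[of "{0<..<b}" x] x
      by (auto elim!: eventually_mono simp: fg)
    ultimately have "(f \<longlongrightarrow> f x) (at x)"
      unfolding fg[OF less_imp_le[OF x(1)] x(2)]
      by (intro Lim_transform_eventually[OF tendsto_ereal]) (auto elim: eventually_mono)
    then show ?thesis
      by (rule tendsto_within_subset) simp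
  qed
  have "(f \<longlongrightarrow> f 0) (at 0 within {0..b})"
  proof -
    \<comment> \<open>The chord that bounds \<open>f\<close> near 0 ends at \<open>b / 2\<close>
      because \<open>f b\<close> may be infinite.\<close>
    obtain c where c: "0 \<le> c" "f (b / 2) = ereal c"
      using b real_cost[of "b / 2"] by auto
    have "((\<lambda>y. ereal (y * c / (b / 2))) \<longlongrightarrow> ereal (0 * c / (b / 2))) (at 0 within {0..b})"
      by (intro tendsto_intros) (use b in auto)
    moreover have "\<forall>\<^sub>F y in at 0 within {0..b}. f y \<le> ereal (y * c / (b / 2))"
    proof -
      have "\<forall>\<^sub>F y in at 0 within {0..b}. y \<in> {0<..<b/2}"
        unfolding eventually_at using b by (intro exI[of _ "b / 2"]) (auto simp: dist_real_def)
      then show ?thesis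
      proof eventually_elim
        case (elim y)
        then have y: "0 < y" "y < b / 2" by auto
        then obtain v where v: "f y = ereal v"
          using real_cost[of y] b by auto
        show ?case
          using three_point[of 0 y "b / 2" 0 v c] y v c b zero by (simp add: field_simps)
      qed
    qed
    moreover have "\<forall>\<^sub>F y in at 0 within {0..b}. 0 \<le> f y"
      unfolding eventually_at using b nonneg by (intro exI[of _ 1]) auto
    ultimately show ?thesis
      using zero tendsto_sandwich[of "\<lambda>_. 0" f _ "\<lambda>y. ereal (y * c / (b / 2))" "0::ereal"]
      by (simp add: zero_ereal_def)
  qed
  moreover have "(f \<longlongrightarrow> f b) (at b within {0..b})"
  proof -
    have "at b within {0..b} = at_left b"
      using b by (intro at_within_nhd[of _ "{0<..}"]) auto
    \<comment> \<open>\<open>lsc_end\<close> controls the limit from below and monotonicity from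
      above; both also work for an infinite \<open>f b\<close>.\<close>
    moreover have "(f \<longlongrightarrow> f b) (at_left b)"
    proof (rule order_tendstoI)
      fix K assume "K < f b"
      then obtain K' :: real where "K < ereal K'" "ereal K' < f b"
        using ereal_dense2 by blast
      then show "\<forall>\<^sub>F y in at_left b. K < f y"
        using lsc_end[OF b \<open>ereal K' < f b\<close>] by (auto elim!: eventually_mono intro: less_trans)
    next
      fix K assume "f b < K"
      moreover have "f y \<le> f b" if "y \<in> {0<..<b}" for y
        using mono[of y b] that by auto
      ultimately show "\<forall>\<^sub>F y in at_left b. f y < K"
        using eventually_at_left_real[OF b]
        by (auto elim!: eventually_mono intro: le_less_trans)
    qed
    ultimately show ?thesis by simp
  qed
  ultimately show ?thesis
    unfolding continuous_on_def using inner by (metis atLeastAtMost_iff order_le_less)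
qed simp

text \<open>A minimizer of the tilted cost \<open>f y - \<beta> * y\<close> is a point with
  subgradient \<beta>; compactness provides one.\<close>

lemma subgradient_exists: "\<exists>x. subgradient f b x \<beta>"
proof -
  have "continuous_on {0..b} (\<lambda>y. f y + ereal (- \<beta> * y))"
    unfolding continuous_on_def
  proof
    fix x assume x: "x \<in> {0..b}"
    show "((\<lambda>y. f y + ereal (- \<beta> * y)) \<longlongrightarrow> f x + ereal (- \<beta> * x)) (at x within {0..b})"
      using continuous x nonneg[of x]
      by (intro tendsto_add_ereal_nonneg tendsto_intros) (auto simp: continuous_on_def)
  qed
  then obtain x where x: "x \<in> {0..b}"
    "\<And>y. y \<in> {0..b} \<Longrightarrow> f x + ereal (- \<beta> * x) \<le> f y + ereal (- \<beta> * y)"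
    using continuous_attains_inf[of "{0..b}" "\<lambda>y. f y + ereal (- \<beta> * y)"] b_nonneg by auto
  have "f x + ereal (\<beta> * (y - x)) \<le> f y" if "y \<in> {0..b}" for y
    using x(2)[OF that] by (cases "f x"; cases "f y") (auto simp: algebra_simps)
  then show ?thesis
    using x(1) by (auto simp: subgradient_def)
qed

text \<open>Adding the two inequalities leaves
  \<open>0 \<le> (\<gamma> - \<beta>) * (y - x)\<close>. At equal slopes nothing follows, since a
  linear piece has many points of one slope.\<close>

lemma subgradient_mono:
  assumes "subgradient f b x \<beta>" "subgradient f b y \<gamma>" "\<beta> < \<gamma>"
  shows "x \<le> y"
proof -
  obtain u where u: "0 \<le> x" "x \<le> b" "f x = ereal u"
    using subgradient_finite[OF assms(1)] by metis
  obtain v where v: "0 \<le> y" "y \<le> b" "f y = ereal v"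
    using subgradient_finite[OF assms(2)] by metis
  have "u + \<beta> * (y - x) \<le> v" "v + \<gamma> * (x - y) \<le> u"
    using subgradientD[OF assms(1)] subgradientD[OF assms(2)] u v by auto
  then have "0 \<le> (\<gamma> - \<beta>) * (y - x)"
    by (simp add: algebra_simps)
  then show ?thesis
    using assms(3) by (simp add: zero_le_mult_iff)
qed

lemma subgradient_limit:
  assumes sub: "\<And>n. subgradient f b (X n) (B n)" and X: "X \<longlonglongrightarrow> x" and B: "B \<longlonglongrightarrow> \<beta>"
  shows "subgradient f b x \<beta>"
proof -
  have Xn: "X n \<in> {0..b}" for n
    using sub by (auto simp: subgradient_def)
  have x: "x \<in> {0..b}"
    using closed_sequentially[of "{0..b}" X x] Xn X by blast
  have fX: "(\<lambda>n. f (X n)) \<longlonglongrightarrow> f x"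
    using continuous_on_tendsto_compose[OF continuous X x] Xn by simp
  have "f x + ereal (\<beta> * (y - x)) \<le> f y" if y: "y \<in> {0..b}" for y
  proof (rule LIMSEQ_le_const2)
    show "(\<lambda>n. f (X n) + ereal (B n * (y - X n))) \<longlonglongrightarrow> f x + ereal (\<beta> * (y - x))"
      using x nonneg[of x] by (intro tendsto_add_ereal_nonneg tendsto_intros fX X B) auto
    show "\<exists>N. \<forall>n\<ge>N. f (X n) + ereal (B n * (y - X n)) \<le> f y"
      using sub y by (auto simp: subgradient_def)
  qed
  then show ?thesis
    using x by (auto simp: subgradient_def)
qed

text \<open>The points of slope \<beta> are the minimizers of one convex function, the tilted
  cost.\<close>

lemma subgradient_segment:
  assumes "subgradient f b x \<beta>" "subgradient f b y \<beta>" "0 \<le> t" "t \<le> 1"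
  shows "subgradient f b ((1 - t) * x + t * y) \<beta>"
proof -
  obtain u where u: "0 \<le> x" "x \<le> b" "f x = ereal u"
    using subgradient_finite[OF assms(1)] by metis
  obtain v where v: "0 \<le> y" "y \<le> b" "f y = ereal v"
    using subgradient_finite[OF assms(2)] by metis
  let ?z = "(1 - t) * x + t * y"
  have z: "?z \<in> {0..b}"
    using convexD[OF convex_real_interval(5)[of 0 b], of x y "1 - t" t] u v assms by simp
  have "f ?z + ereal (\<beta> * (w - ?z)) \<le> f w" if w: "w \<in> {0..b}" for w
  proof -
    have "f ?z \<le> ereal ((1 - t) * u + t * v)"
      using convex[of x y t] u v assms by simp
    then have "f ?z + ereal (\<beta> * (w - ?z)) \<le>
        ereal ((1 - t) * u + t * v) + ereal (\<beta> * (w - ?z))"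
      by (rule add_right_mono)
    also have "\<dots> = ereal ((1 - t) * (u + \<beta> * (w - x)) + t * (v + \<beta> * (w - y)))"
      by (simp add: algebra_simps)
    also have "\<dots> \<le> f w"
    proof (cases "f w")
      case (real c)
      then have "u + \<beta> * (w - x) \<le> c" "v + \<beta> * (w - y) \<le> c"
        using subgradientD[OF assms(1)] subgradientD[OF assms(2)] w u v by auto
      then show ?thesis
        using real assms convex_bound_le[of "u + \<beta> * (w - x)" c "v + \<beta> * (w - y)" "1 - t" t]
        by simp
    qed (use nonneg[of w] w in auto)
    finally show ?thesis .
  qed
  then show ?thesis
    using z by (auto simp: subgradient_def)
qed

text \<open>From a point \<open>x < y\<close> of slope \<beta> the cost would rise by at least
  \<open>\<beta> * (z - y)\<close> up to \<open>z\<close>, impossible once this exceeds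
  \<open>f z\<close>.\<close>

lemma subgradient_large:
  assumes "0 \<le> y" "y < b \<or> y = 0"
  shows "\<forall>\<^sub>F \<beta> in at_top. \<forall>x. subgradient f b x \<beta> \<longrightarrow> y \<le> x"
proof (cases "y = 0")
  case False
  then have y: "0 < y" "y < b"
    using assms by auto
  \<comment> \<open>The midpoint has a finite cost, which \<open>b\<close> need not have, and a
    positive distance from \<open>y\<close>.\<close>
  define z where "z = (y + b) / 2"
  have z: "0 \<le> z" "y < z" "z < b"
    using y by (auto simp: z_def)
  obtain v where v: "f z = ereal v"
    using real_cost[OF z(1,3)] by metis
  show ?thesis
    using eventually_gt_at_top[of "max 0 (v / (z - y))"]
  proof eventually_elim
    case (elim \<beta>)
    then have \<beta>: "0 < \<beta>" "v < \<beta> * (z - y)"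
      using z by (auto simp: field_simps)
    have False if sub: "subgradient f b x \<beta>" and xy: "x < y" for x
    proof -
      obtain u where u: "0 \<le> u" "f x = ereal u"
        using subgradient_finite[OF sub] by blast
      have "u + \<beta> * (z - x) \<le> v"
        using subgradientD[OF sub] z u v by auto
      moreover have "\<beta> * (z - y) \<le> \<beta> * (z - x)"
        using \<beta> xy by simp
      ultimately show False
        using u \<beta> by linarith
    qed
    then show ?case
      using not_le by blast
  qed
qed (auto simp: subgradient_def)

lemma monotone_subgradients_converge:
  assumes sub: "\<And>n. subgradient f b (X n) (B n)" and "monoseq X" and B: "B \<longlonglongrightarrow> \<beta>"
  shows "\<exists>x. X \<longlonglongrightarrow> x \<and> subgradient f b x \<beta>"
proof -
  have "X n \<in> {0..b}" for n
    using sub by (auto simp: subgradient_def)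
  then have "Bseq X"
    by (intro BseqI'[of _ b]) auto
  then obtain x where "X \<longlonglongrightarrow> x"
    using Bseq_monoseq_convergent \<open>monoseq X\<close> convergent_def by blast
  then show ?thesis
    using subgradient_limit[OF sub _ B] by blast
qed

end

section \<open>Existence of a common multiplier\<close>

text \<open>A selection of subgradient points is monotone in the slope, so the throughput it produces
  jumps over the target at some slope; both one-sided limits there are subgradient points, and the
  target lies on the segment between them.\<close>

lemma multiplier_exists:
  fixes \<pi> b :: "'i \<Rightarrow> real"
  assumes fin: "finite I" and \<pi>: "\<And>i. i \<in> I \<Longrightarrow> 0 \<le> \<pi> i"
    and cost: "\<And>i. i \<in> I \<Longrightarrow> convex_cost (f i) (b i)"
    and \<rho>: "0 \<le> \<rho>" "\<rho> < (\<Sum>i\<in>I. \<pi> i * b i)"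
  shows "\<exists>\<beta>\<ge>0. \<exists>r. (\<forall>i\<in>I. subgradient (f i) (b i) (r i) \<beta>) \<and> (\<Sum>i\<in>I. \<pi> i * r i) = \<rho>"
proof -
  define X where "X i \<beta> = (SOME x. subgradient (f i) (b i) x \<beta>)" for i \<beta>
  have X: "subgradient (f i) (b i) (X i \<beta>) \<beta>" if "i \<in> I" for i \<beta>
    unfolding X_def using convex_cost.subgradient_exists[OF cost[OF that]] by (rule someI_ex)
  have X_mono: "X i \<beta> \<le> X i \<gamma>" if "i \<in> I" "\<beta> \<le> \<gamma>" for i \<beta> \<gamma>
    using convex_cost.subgradient_mono[OF cost[OF that(1)] X X] that
    by (cases "\<beta> = \<gamma>") auto
  define G where "G \<beta> = (\<Sum>i\<in>I. \<pi> i * X i \<beta>)" for \<beta>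
  have G_mono: "G \<beta> \<le> G \<gamma>" if "\<beta> \<le> \<gamma>" for \<beta> \<gamma>
    unfolding G_def using that \<pi> by (intro sum_mono mult_left_mono X_mono) auto
  have "\<forall>\<^sub>F \<beta> in at_top. \<rho> \<le> G \<beta>"
  proof -
    \<comment> \<open>Scaling all maximal rates by \<open>\<theta> < 1\<close> meets the target
      exactly and stays below every positive \<open>b i\<close>, so a large slope pushes all rates
      past these values.\<close>
    define \<theta> where "\<theta> = \<rho> / (\<Sum>i\<in>I. \<pi> i * b i)"
    have \<theta>: "0 \<le> \<theta>" "\<theta> < 1" "\<theta> * (\<Sum>i\<in>I. \<pi> i * b i) = \<rho>"
      using \<rho> by (auto simp: \<theta>_def)
    have "\<forall>\<^sub>F \<beta> in at_top. \<forall>x. subgradient (f i) (b i) x \<beta> \<longrightarrow> \<theta> * b i \<le> x" if "i \<in> I" for i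
    proof (rule convex_cost.subgradient_large[OF cost[OF that]])
      have "0 \<le> b i"
        using convex_cost.b_nonneg[OF cost[OF that]] .
      then show "0 \<le> \<theta> * b i" "\<theta> * b i < b i \<or> \<theta> * b i = 0"
        using \<theta> mult_strict_right_mono[of \<theta> 1 "b i"] by (cases "b i = 0"; simp)+
    qed
    then have "\<forall>\<^sub>F \<beta> in at_top. \<forall>i\<in>I. \<forall>x. subgradient (f i) (b i) x \<beta> \<longrightarrow> \<theta> * b i \<le> x"
      using fin by (intro eventually_ball_finite) auto
    then show ?thesis
    proof eventually_elim
      case (elim \<beta>)
      then have "(\<Sum>i\<in>I. \<pi> i * (\<theta> * b i)) \<le> G \<beta>"
        unfolding G_def using \<pi> X by (intro sum_mono mult_left_mono) auto
      moreover have "(\<Sum>i\<in>I. \<pi> i * (\<theta> * b i)) = \<theta> * (\<Sum>i\<in>I. \<pi> i * b i)"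
        by (simp add: sum_distrib_left algebra_simps)
      ultimately show ?case
        using \<theta>(3) by simp
    qed
  qed
  then obtain \<beta>\<^sub>0 where \<beta>\<^sub>0: "0 \<le> \<beta>\<^sub>0" "\<rho> \<le> G \<beta>\<^sub>0"
    using eventually_happens'[OF _ eventually_conj[OF eventually_ge_at_top[of 0]]]
    by (metis trivial_limit_at_top_linorder)
  define A where "A = {\<beta>. 0 \<le> \<beta> \<and> \<rho> \<le> G \<beta>}"
  define s where "s = Inf A"
  have A: "A \<noteq> {}" "bdd_below A"
    using \<beta>\<^sub>0 by (auto simp: A_def intro!: bdd_belowI[of _ 0])
  have s: "0 \<le> s"
    unfolding s_def using A by (intro cInf_greatest) (auto simp: A_def)
  have above: "\<rho> \<le> G \<beta>" if s_less: "s < \<beta>" for \<beta>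
  proof -
    obtain a where "a \<in> A" "a < \<beta>"
      using cInf_less_iff[OF A, of \<beta>] s_less unfolding s_def by blast
    then show ?thesis
      using G_mono[of a \<beta>] by (auto simp: A_def)
  qed
  have below: "G \<beta> \<le> \<rho>" if "0 \<le> \<beta>" "\<beta> < s" for \<beta>
    using cInf_lower[of \<beta> A] A that by (fastforce simp: A_def s_def)
  have "\<exists>u. (\<forall>i\<in>I. subgradient (f i) (b i) (u i) s) \<and> \<rho> \<le> (\<Sum>i\<in>I. \<pi> i * u i)"
  proof -
    define B where "B n = s + inverse (real (Suc n))" for n
    have "B \<longlonglongrightarrow> s + 0"
      unfolding B_def by (intro tendsto_intros LIMSEQ_inverse_real_of_nat)
    then have B: "B \<longlonglongrightarrow> s" by simp
    have "monoseq (\<lambda>n. X i (B n))" if "i \<in> I" for i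
      using that by (intro monoI2 allI impI X_mono) (auto simp: B_def field_simps)
    then have "\<forall>i\<in>I. \<exists>x. (\<lambda>n. X i (B n)) \<longlonglongrightarrow> x \<and> subgradient (f i) (b i) x s"
      using convex_cost.monotone_subgradients_converge[OF cost X _ B] by blast
    then obtain u where u: "\<And>i. i \<in> I \<Longrightarrow> (\<lambda>n. X i (B n)) \<longlonglongrightarrow> u i"
      "\<And>i. i \<in> I \<Longrightarrow> subgradient (f i) (b i) (u i) s"
      by metis
    have "(\<lambda>n. G (B n)) \<longlonglongrightarrow> (\<Sum>i\<in>I. \<pi> i * u i)"
      unfolding G_def by (intro tendsto_intros u)
    moreover have "\<rho> \<le> G (B n)" for n
      by (rule above) (simp add: B_def)
    ultimately show ?thesis
      using u(2) by (intro exI[of _ u]) (auto intro: LIMSEQ_le_const)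
  qed
  moreover have "\<exists>l. (\<forall>i\<in>I. subgradient (f i) (b i) (l i) s) \<and> (\<Sum>i\<in>I. \<pi> i * l i) \<le> \<rho>"
  proof (cases "s = 0")
    case True
    \<comment> \<open>No nonnegative slope lies left of 0, so zero rates replace the limit from the
      left; they have slope 0 because costs are nonnegative.\<close>
    have "subgradient (f i) (b i) 0 0" if "i \<in> I" for i
    proof -
      interpret convex_cost "f i" "b i"
        using cost that .
      show ?thesis
        using b_nonneg zero nonneg by (auto simp: subgradient_def)
    qed
    then show ?thesis
      using True \<rho> by (intro exI[of _ "\<lambda>_. 0"]) auto
  next
    case False
    \<comment> \<open>The factor \<open>s\<close> keeps \<open>B n\<close> nonnegative, as
      \<open>below\<close> requires; \<open>B 0\<close> is exactly 0.\<close>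
    define B where "B n = s - s * inverse (real (Suc n))" for n
    have "B \<longlonglongrightarrow> s - s * 0"
      unfolding B_def by (intro tendsto_intros LIMSEQ_inverse_real_of_nat)
    then have B: "B \<longlonglongrightarrow> s" by simp
    have "B m \<le> B n" if "m \<le> n" for m n
      using that s unfolding B_def by (intro diff_left_mono mult_left_mono) auto
    then have "monoseq (\<lambda>n. X i (B n))" if "i \<in> I" for i
      using that by (intro monoI1 allI impI X_mono) auto
    then have "\<forall>i\<in>I. \<exists>x. (\<lambda>n. X i (B n)) \<longlonglongrightarrow> x \<and> subgradient (f i) (b i) x s"
      using convex_cost.monotone_subgradients_converge[OF cost X _ B] by blast
    then obtain l where l: "\<And>i. i \<in> I \<Longrightarrow> (\<lambda>n. X i (B n)) \<longlonglongrightarrow> l i"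
      "\<And>i. i \<in> I \<Longrightarrow> subgradient (f i) (b i) (l i) s"
      by metis
    have "(\<lambda>n. G (B n)) \<longlonglongrightarrow> (\<Sum>i\<in>I. \<pi> i * l i)"
      unfolding G_def by (intro tendsto_intros l)
    moreover have "G (B n) \<le> \<rho>" for n
    proof (rule below)
      have "s * inverse (real (Suc n)) \<le> s * 1"
        using s by (intro mult_left_mono) (auto simp: field_simps)
      then show "0 \<le> B n" by (simp add: B_def)
      show "B n < s" using s False by (simp add: B_def)
    qed
    ultimately show ?thesis
      using l(2) by (intro exI[of _ l]) (auto intro: LIMSEQ_le_const2)
  qed
  ultimately obtain l u where
    l: "\<And>i. i \<in> I \<Longrightarrow> subgradient (f i) (b i) (l i) s" "(\<Sum>i\<in>I. \<pi> i * l i) \<le> \<rho>" and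
    u: "\<And>i. i \<in> I \<Longrightarrow> subgradient (f i) (b i) (u i) s" "\<rho> \<le> (\<Sum>i\<in>I. \<pi> i * u i)"
    by metis
  obtain t where t: "0 \<le> t" "t \<le> 1"
    "(1 - t) * (\<Sum>i\<in>I. \<pi> i * l i) + t * (\<Sum>i\<in>I. \<pi> i * u i) = \<rho>"
  proof -
    have "\<rho> \<in> closed_segment (\<Sum>i\<in>I. \<pi> i * l i) (\<Sum>i\<in>I. \<pi> i * u i)"
      using l(2) u(2) by (simp add: closed_segment_eq_real_ivl)
    then show ?thesis
      using that by (auto simp: in_segment)
  qed
  have "(\<Sum>i\<in>I. \<pi> i * ((1 - t) * l i + t * u i)) = \<rho>"
    unfolding t(3)[symmetric] by (simp add: sum_distrib_left sum.distrib algebra_simps sum_subtractf)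
  then show ?thesis
    using s l(1) u(1) t(1,2) convex_cost.subgradient_segment[OF cost]
    by (intro exI[of _ s] conjI exI[of _ "\<lambda>i. (1 - t) * l i + t * u i"]) auto
qed

section \<open>Optimality of a common slope\<close>

text \<open>Equal totals cancel the terms with \<beta>, so a finite cost difference is a weighted
  sum of nonnegative slacks. If it vanishes, so does every slack of positive weight; a zero weight
  hides its slack.\<close>

lemma subgradient_minimizes:
  fixes \<pi> b :: "'i \<Rightarrow> real"
  assumes fin: "finite I" and \<pi>: "\<And>i. i \<in> I \<Longrightarrow> 0 \<le> \<pi> i"
    and cost: "\<And>i. i \<in> I \<Longrightarrow> convex_cost (f i) (b i)"
    and sub: "\<And>i. i \<in> I \<Longrightarrow> subgradient (f i) (b i) (r i) \<beta>"
    and r': "\<And>i. i \<in> I \<Longrightarrow> r' i \<in> {0..b i}"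
    and eq: "(\<Sum>i\<in>I. \<pi> i * r' i) = (\<Sum>i\<in>I. \<pi> i * r i)"
  shows "(\<Sum>i\<in>I. ereal (\<pi> i) * f i (r i)) \<le> (\<Sum>i\<in>I. ereal (\<pi> i) * f i (r' i))"
    and "\<lbrakk>(\<Sum>i\<in>I. ereal (\<pi> i) * f i (r' i)) \<le> (\<Sum>i\<in>I. ereal (\<pi> i) * f i (r i)); i \<in> I; 0 < \<pi> i\<rbrakk>
      \<Longrightarrow> subgradient (f i) (b i) (r' i) \<beta>"
proof -
  let ?C = "\<Sum>i\<in>I. ereal (\<pi> i) * f i (r i)" and ?C' = "\<Sum>i\<in>I. ereal (\<pi> i) * f i (r' i)"
  have "\<forall>i\<in>I. \<exists>u. f i (r i) = ereal u"
    using convex_cost.subgradient_finite[OF cost sub] by metis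
  then obtain u where u: "\<And>i. i \<in> I \<Longrightarrow> f i (r i) = ereal (u i)"
    by metis
  then have C: "?C = ereal (\<Sum>i\<in>I. \<pi> i * u i)"
    by (simp flip: sum_ereal)
  have nonneg: "0 \<le> f i (r' i)" if "i \<in> I" for i
    using convex_cost.nonneg[OF cost[OF that]] r'[OF that] by simp
  have "?C \<le> ?C' \<and> (?C' \<le> ?C \<longrightarrow> (\<forall>i\<in>I. 0 < \<pi> i \<longrightarrow> subgradient (f i) (b i) (r' i) \<beta>))"
  proof (cases "\<exists>i\<in>I. 0 < \<pi> i \<and> f i (r' i) = \<infinity>")
    case True
    then have "?C' = \<infinity>"
      unfolding sum_Pinfty using fin by auto
    then show ?thesis
      by (simp add: C)
  next
    case False
    \<comment> \<open>A class of weight 0 may have infinite cost. Then \<open>v i\<close> is the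
      default 0, and the weighted terms still agree because
      \<open>0 * \<infinity> = 0\<close>.\<close>
    define v where "v i = real_of_ereal (f i (r' i))" for i
    have v: "f i (r' i) = ereal (v i)" if "i \<in> I" "0 < \<pi> i" for i
      using False nonneg[OF that(1)] that by (cases "f i (r' i)") (auto simp: v_def)
    have "ereal (\<pi> i) * f i (r' i) = ereal (\<pi> i * v i)" if "i \<in> I" for i
      using v[OF that] \<pi>[OF that] by (cases "\<pi> i = 0") (auto simp: zero_ereal_def[symmetric])
    then have C': "?C' = ereal (\<Sum>i\<in>I. \<pi> i * v i)"
      by (simp flip: sum_ereal)
    define d where "d i = \<pi> i * (v i - u i - \<beta> * (r' i - r i))" for i
    have d: "0 \<le> d i" if "i \<in> I" for i
    proof (cases "\<pi> i = 0")
      case False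
      then have "0 < \<pi> i"
        using \<pi>[OF that] by simp
      then have "u i + \<beta> * (r' i - r i) \<le> v i"
        using convex_cost.subgradientD[OF cost sub u _ _ v] that r'[OF that] by simp
      then show ?thesis
        using \<pi>[OF that] by (simp add: d_def)
    qed (simp add: d_def)
    have "(\<Sum>i\<in>I. d i) = (\<Sum>i\<in>I. \<pi> i * v i) - (\<Sum>i\<in>I. \<pi> i * u i)
        - \<beta> * ((\<Sum>i\<in>I. \<pi> i * r' i) - (\<Sum>i\<in>I. \<pi> i * r i))"
      by (simp add: d_def algebra_simps sum.distrib sum_subtractf sum_distrib_left)
    then have sum_d: "(\<Sum>i\<in>I. d i) = (\<Sum>i\<in>I. \<pi> i * v i) - (\<Sum>i\<in>I. \<pi> i * u i)"
      by (simp add: eq)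
    show ?thesis
    proof (intro conjI impI ballI)
      show "?C \<le> ?C'"
        using sum_nonneg[of I d] d sum_d by (simp add: C C')
      fix i assume "?C' \<le> ?C" and i: "i \<in> I" "0 < \<pi> i"
      then have "(\<Sum>i\<in>I. d i) = 0"
        using sum_nonneg[of I d] d sum_d by (simp add: C C')
      then have "d i = 0"
        using sum_nonneg_eq_0_iff[OF fin, of d] d i by simp
      then have "v i = u i + \<beta> * (r' i - r i)"
        using i by (simp add: d_def)
      \<comment> \<open>Zero slack puts \<open>r' i\<close> on the supporting line at
        \<open>r i\<close>, so one line supports \<open>f i\<close> at both points.\<close>
      then have "f i (r' i) + ereal (\<beta> * (y - r' i)) = f i (r i) + ereal (\<beta> * (y - r i))" for y
        using i by (simp add: u v algebra_simps)
      then show "subgradient (f i) (b i) (r' i) \<beta>"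
        using sub[OF i(1)] r'[OF i(1)] by (simp add: subgradient_def)
    qed
  qed
  then show "?C \<le> ?C'" "\<lbrakk>?C' \<le> ?C; i \<in> I; 0 < \<pi> i\<rbrakk> \<Longrightarrow> subgradient (f i) (b i) (r' i) \<beta>"
    by auto
qed

section \<open>The optimal rate-cost function\<close>

lemma convex_on_max_zero_affine:
  fixes a c :: real
  assumes "0 \<le> c" "convex S"
  shows "convex_on S (\<lambda>x. max 0 (c * (x - a)))"
proof (rule convex_onI)
  fix t x y :: real
  assume t: "0 < t" "t < 1"
  have "c * (((1 - t) *\<^sub>R x + t *\<^sub>R y) - a) = (1 - t) * (c * (x - a)) + t * (c * (y - a))"
    by (simp add: algebra_simps)
  also have "\<dots> \<le> (1 - t) * max 0 (c * (x - a)) + t * max 0 (c * (y - a))"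
    using t by (intro add_mono mult_left_mono) auto
  finally show "max 0 (c * (((1 - t) *\<^sub>R x + t *\<^sub>R y) - a)) \<le>
      (1 - t) * max 0 (c * (x - a)) + t * max 0 (c * (y - a))"
    using t by simp
qed (fact assms)

section \<open>The delay distribution and its quantile\<close>

locale request_delay = prob_space M for M :: "ereal measure" +
  assumes delay_distribution: "delay_distribution M"
begin

abbreviation "q \<equiv> never_prob M"
abbreviation "P \<equiv> delay_cdf M"
abbreviation "T \<equiv> delay_quantile M"

lemma sets_M [measurable_cong]: "sets M = sets borel"
  using delay_distribution by (simp add: delay_distribution_def)

lemma space_M [simp]: "space M = UNIV"
  using sets_eq_imp_space_eq[OF sets_M] by simp

lemma sets_intervals [simp]: "{..x} \<in> sets M" "{..<x} \<in> sets M" "{x<..y} \<in> sets M" "{x..y} \<in> sets M"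
  by (simp_all add: sets_M)

lemma AE_less_infinity: "AE x in M. x < \<infinity>"
  using delay_distribution by (auto simp: delay_distribution_def elim!: eventually_mono)

lemma cdf_0: "P 0 = q"
  using delay_distribution by (simp add: delay_distribution_def)

lemma q_bounds: "0 \<le> q" "q \<le> 1"
  by (simp_all add: never_prob_def)

lemma cdf_mono: "x \<le> y \<Longrightarrow> P x \<le> P y"
  unfolding delay_cdf_def by (intro finite_measure_mono) auto

lemma cdf_PInf: "P \<infinity> = 1"
proof -
  have "{..\<infinity>::ereal} = space M" by auto
  then show ?thesis
    unfolding delay_cdf_def using prob_space by metis
qed

lemma prob_less_infinity: "prob {..<\<infinity>} = 1"
  using AE_less_infinity by (subst prob_eq_1) auto

text \<open>\<open>{..<a}\<close> is an increasing union of closed rays, so its probability is the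
  left limit of \<open>P\<close> at \<open>a\<close>. With \<open>a = \<infinity>\<close> this
  yields finite quantiles at levels below 1.\<close>

lemma cdf_sup:
  assumes "z < prob {..<a}" "-\<infinity> < a"
  shows "\<exists>t<a. z < P t"
proof -
  obtain u where u: "incseq u" "\<And>n. ereal (u n) < a" "(\<lambda>n. ereal (u n)) \<longlonglongrightarrow> a"
    using ereal_incseq_approx[OF assms(2)] by metis
  have "(\<Union>n. {..ereal (u n)}) = {..<a}"
  proof (intro set_eqI iffI)
    fix x assume "x \<in> {..<a}"
    then have "\<forall>\<^sub>F n in sequentially. x < ereal (u n)"
      using u(3) by (auto intro: order_tendstoD)
    then show "x \<in> (\<Union>n. {..ereal (u n)})"
      using eventually_happens by (force intro: less_imp_le)
  qed (use u(2) in \<open>auto intro: le_less_trans\<close>)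
  then have "(\<lambda>n. P (u n)) \<longlonglongrightarrow> prob {..<a}"
    using finite_Lim_measure_incseq[of "\<lambda>n. {..ereal (u n)}"] u(1)
    by (fastforce simp: delay_cdf_def incseq_def intro: order_trans)
  then have "\<forall>\<^sub>F n in sequentially. z < P (u n)"
    using assms(1) by (rule order_tendstoD)
  then show ?thesis
    using u(2) eventually_happens by force
qed

text \<open>The infimum in the quantile is attained because the distribution function is continuous from
  the right.\<close>

lemma cdf_quantile_ge:
  assumes "z \<le> 1"
  shows "z \<le> P (T z)"
proof (cases "T z = \<infinity>")
  case True
  then show ?thesis using assms by (simp add: cdf_PInf)
next
  case False
  then obtain u where u: "\<And>n. T z < ereal (u n)" "decseq u" "(\<lambda>n. ereal (u n)) \<longlonglongrightarrow> T z"
    using ereal_decseq_approx[of "T z" \<infinity>] by (metis ereal_infty_less(1))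
  have "z \<le> P (u n)" for n
  proof -
    obtain x where "z \<le> P x" "x < u n"
      using u(1)[of n] unfolding delay_quantile_def Inf_less_iff by auto
    then show ?thesis
      using cdf_mono[of x "u n"] by (meson less_imp_le order_trans)
  qed
  moreover have "(\<lambda>n. P (u n)) \<longlonglongrightarrow> prob (\<Inter>n. {..ereal (u n)})"
    unfolding delay_cdf_def using u(2)
    by (intro finite_Lim_measure_decseq) (auto simp: decseq_def dest: order_trans)
  moreover have "(\<Inter>n. {..ereal (u n)}) = {..T z}"
  proof (intro set_eqI iffI)
    fix x assume "x \<in> (\<Inter>n. {..ereal (u n)})"
    then show "x \<in> {..T z}"
      using LIMSEQ_le_const[OF u(3), of x] by auto
  qed (use u(1) in \<open>auto intro: order_trans less_imp_le\<close>)
  ultimately show ?thesis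
    using LIMSEQ_le_const[of "\<lambda>n. P (u n)" _ z] by (simp add: delay_cdf_def)
qed

lemma quantile_mono: "y \<le> z \<Longrightarrow> T y \<le> T z"
  unfolding delay_quantile_def by (intro Inf_superset_mono) auto

lemma quantile_gt: "P x < z \<Longrightarrow> z \<le> 1 \<Longrightarrow> x < T z"
  using cdf_quantile_ge[of z] cdf_mono[of "T z" x] by (meson leD le_less_trans not_le order_trans)

lemma quantile_less_infinity:
  assumes "z < 1"
  shows "T z < \<infinity>"
proof -
  obtain t where "t < \<infinity>" "z < P t"
    using cdf_sup[of z \<infinity>] assms by (auto simp: prob_less_infinity)
  moreover from this have "T z \<le> t"
    unfolding delay_quantile_def by (intro Inf_lower) auto
  ultimately show ?thesis
    by (meson le_less_trans)
qed

lemma quantile_pos: "q < z \<Longrightarrow> z \<le> 1 \<Longrightarrow> 0 < T z"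
  using quantile_gt[of 0 z] by (simp add: cdf_0)

section \<open>Truncated means and the static cost\<close>

text \<open>The caching time due to requests arriving by \<open>t\<close>. Items that are never
  requested lie outside \<open>{0..t}\<close> and are charged through the summand
  \<open>(1 - r) * T (r + q)\<close>.\<close>

definition partial_mean :: "ereal \<Rightarrow> ereal" where
  "partial_mean t = enn2ereal (\<integral>\<^sup>+x\<in>{0..t}. e2ennreal x \<partial>M)"

lemma static_cost_eq: "static_cost M r = partial_mean (T (r + q)) + ereal (1 - r) * T (r + q)"
  by (simp add: static_cost_def partial_mean_def Let_def)

lemma partial_mean_mono: "s \<le> t \<Longrightarrow> partial_mean s \<le> partial_mean t"
  unfolding partial_mean_def less_eq_ennreal.rep_eq[symmetric]
  by (intro nn_integral_mono) (auto intro: order_trans split: split_indicator)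

lemma partial_mean_nonneg: "0 \<le> partial_mean t"
  by (simp add: partial_mean_def)

lemma partial_mean_less_infinity:
  assumes "t < \<infinity>"
  shows "partial_mean t < \<infinity>"
proof -
  have "(\<integral>\<^sup>+x\<in>{0..t}. e2ennreal x \<partial>M) \<le> (\<integral>\<^sup>+x. e2ennreal t \<partial>M)"
    by (intro nn_integral_mono) (auto split: split_indicator intro: e2ennreal_mono)
  also have "\<dots> = e2ennreal t"
    using emeasure_space_1 by simp
  also have "\<dots> < \<infinity>"
    using assms by (cases t) (auto simp: e2ennreal_neg)
  finally show ?thesis
    unfolding partial_mean_def by (simp add: less_ennreal.rep_eq)
qed

text \<open>A zero integral would leave no mass between 0 and \<open>t\<close>, contrary to
  \<open>P 0 = q < P t\<close>.\<close>

lemma partial_mean_pos: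
  assumes "q < P t"
  shows "0 < partial_mean t"
proof -
  have "\<not> (AE x in M. e2ennreal x * indicator {0..t} x = 0)"
  proof
    assume "AE x in M. e2ennreal x * indicator {0..t} x = 0"
    then have "AE x in M. x \<in> {..t} \<longrightarrow> x \<in> {..0}"
    proof eventually_elim
      case (elim x)
      have "x \<le> 0" if "e2ennreal x = 0"
        using that enn2ereal_e2ennreal[of x] by (cases "0 \<le> x") (auto simp: zero_ennreal.rep_eq)
      then show ?case
        using elim by (cases "0 \<le> x") (auto split: split_indicator_asm)
    qed
    then have "prob {..t} \<le> prob {..0}"
      by (intro finite_measure_mono_AE) auto
    then show False
      using assms cdf_0 by (simp add: delay_cdf_def)
  qed
  then have "(\<integral>\<^sup>+x\<in>{0..t}. e2ennreal x \<partial>M) \<noteq> 0"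
    by (subst nn_integral_0_iff_AE) auto
  then show ?thesis
    unfolding partial_mean_def zero_ennreal.rep_eq[symmetric] less_ennreal.rep_eq[symmetric]
    by (simp add: zero_less_iff_neq_zero)
qed

lemma static_cost_nonneg: "0 < r \<Longrightarrow> r \<le> 1 - q \<Longrightarrow> 0 \<le> static_cost M r"
  unfolding static_cost_eq using quantile_pos[of "r + q"] q_bounds
  by (intro add_nonneg_nonneg ereal_0_le_mult partial_mean_nonneg) (auto simp: less_imp_le)

lemma static_cost_less_infinity: "0 < r \<Longrightarrow> r < 1 - q \<Longrightarrow> static_cost M r < \<infinity>"
  unfolding static_cost_eq
  using quantile_less_infinity[of "r + q"] quantile_pos[of "r + q"] partial_mean_nonneg
    partial_mean_less_infinity[of "T (r + q)"]
  by (cases "T (r + q)"; cases "partial_mean (T (r + q))") auto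

text \<open>The truncated mean alone provides the bound: it is positive already at
  \<open>T (\<epsilon> + q)\<close> and grows with \<open>r\<close>.\<close>

lemma static_cost_bounded_below:
  assumes "0 < \<epsilon>" "\<epsilon> < 1 - q"
  shows "\<exists>K>0. \<forall>r. \<epsilon> < r \<longrightarrow> r \<le> 1 - q \<longrightarrow> ereal K \<le> static_cost M r"
proof -
  have "q < P (T (\<epsilon> + q))"
    using cdf_quantile_ge[of "\<epsilon> + q"] assms by simp
  then obtain K where K: "0 < ereal K" "ereal K < partial_mean (T (\<epsilon> + q))"
    using partial_mean_pos ereal_dense2 by blast
  have "ereal K \<le> static_cost M r" if "\<epsilon> < r" "r \<le> 1 - q" for r
  proof -
    have "ereal K + 0 \<le> static_cost M r"
      unfolding static_cost_eq
    proof (rule add_mono)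
      show "ereal K \<le> partial_mean (T (r + q))"
        using K(2) partial_mean_mono[OF quantile_mono[of "\<epsilon> + q" "r + q"]] that by simp
      show "0 \<le> ereal (1 - r) * T (r + q)"
        using quantile_pos[of "r + q"] that assms q_bounds by (intro ereal_0_le_mult) (auto simp: less_imp_le)
    qed
    then show ?thesis by simp
  qed
  then show ?thesis
    using K(1) by auto
qed

text \<open>Monotone convergence only reaches \<open>{0..<a}\<close>; the assumption on
  \<open>a\<close> excludes an atom at \<open>a\<close> itself.\<close>

lemma partial_mean_tendsto:
  fixes u :: "nat \<Rightarrow> real"
  assumes u: "\<And>n. ereal (u n) < a" "incseq u" "(\<lambda>n. ereal (u n)) \<longlonglongrightarrow> a" and a: "prob {..<a} = 1"
  shows "(\<lambda>n. partial_mean (u n)) \<longlonglongrightarrow> partial_mean a"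
proof -
  have "(\<lambda>n. e2ennreal x * indicator {0..ereal (u n)} x) \<longlonglongrightarrow> e2ennreal x * indicator {0..<a} x" for x
  proof (cases "x < a")
    case True
    then have "\<forall>\<^sub>F n in sequentially. x < ereal (u n)"
      using u(3) by (auto intro: order_tendstoD)
    then have "\<forall>\<^sub>F n in sequentially.
        e2ennreal x * indicator {0..<a} x = e2ennreal x * indicator {0..ereal (u n)} x"
      by eventually_elim (use True in \<open>auto split: split_indicator\<close>)
    then show ?thesis
      by (rule Lim_transform_eventually[OF tendsto_const])
  next
    case False
    then have "\<not> x \<le> ereal (u n)" for n
      using u(1)[of n] by auto
    then show ?thesis
      using False by (simp add: indicator_def)
  qed
  moreover have "incseq (\<lambda>n x. e2ennreal x * indicator {0..ereal (u n)} x)"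
    using u(2) by (auto simp: incseq_def le_fun_def intro: order_trans split: split_indicator)
  ultimately have "(\<lambda>n. \<integral>\<^sup>+x\<in>{0..ereal (u n)}. e2ennreal x \<partial>M) \<longlonglongrightarrow> (\<integral>\<^sup>+x\<in>{0..<a}. e2ennreal x \<partial>M)"
    by (intro nn_integral_LIMSEQ) auto
  also have "AE x in M. x < a"
    using a by (subst (asm) prob_eq_1) auto
  then have "(\<integral>\<^sup>+x\<in>{0..<a}. e2ennreal x \<partial>M) = (\<integral>\<^sup>+x\<in>{0..a}. e2ennreal x \<partial>M)"
    by (intro nn_integral_cong_AE) (auto elim!: eventually_mono split: split_indicator)
  finally show ?thesis
    unfolding partial_mean_def by (rule tendsto_enn2erealI)
qed

text \<open>If the largest delay \<open>a = T 1\<close> is an atom, the quantile is constant near the endpoint;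
  otherwise the truncated means converge by monotone convergence.\<close>

lemma static_cost_lsc_end:
  assumes q: "q < 1" and K: "ereal K < static_cost M (1 - q)"
  shows "\<exists>\<epsilon>\<in>{0<..<1 - q}. \<forall>r. \<epsilon> < r \<longrightarrow> r \<le> 1 - q \<longrightarrow> ereal K \<le> static_cost M r"
proof -
  define a where "a = T 1"
  have a: "0 < a"
    unfolding a_def using quantile_pos q by simp
  \<comment> \<open>At \<open>r = 1 - q\<close> the coefficient \<open>1 - r\<close> is
    \<open>q\<close> and the quantile level is 1.\<close>
  have K': "ereal K < partial_mean a + ereal q * a"
    using K by (simp add: static_cost_eq a_def)
  \<comment> \<open>It suffices to find a time \<open>t\<close> that the quantile reaches at all
    levels near 1 and whose value already exceeds \<open>K\<close>, since truncated means are
    monotone and \<open>1 - r\<close> is at least \<open>q\<close>.\<close>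
  have main: "\<exists>\<epsilon>\<in>{0<..<1 - q}. \<forall>r. \<epsilon> < r \<longrightarrow> r \<le> 1 - q \<longrightarrow> ereal K \<le> static_cost M r"
    if s: "s < 1" "\<And>z. s < z \<Longrightarrow> z \<le> 1 \<Longrightarrow> t \<le> T z" and t: "0 \<le> t"
      "ereal K < partial_mean t + ereal q * t" for s t
  proof -
    define \<epsilon> where "\<epsilon> = max (s - q) ((1 - q) / 2)"
    have "ereal K \<le> static_cost M r" if r: "\<epsilon> < r" "r \<le> 1 - q" for r
    proof -
      have tT: "t \<le> T (r + q)"
        using s(2)[of "r + q"] r by (simp add: \<epsilon>_def)
      have "ereal q * t \<le> ereal (1 - r) * T (r + q)"
        using tT t r q_bounds by (intro ereal_mult_mono) (auto intro: order_trans)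
      then have "partial_mean t + ereal q * t \<le> static_cost M r"
        unfolding static_cost_eq by (intro add_mono partial_mean_mono tT)
      then show ?thesis
        using t(2) by simp
    qed
    moreover have "\<epsilon> \<in> {0<..<1 - q}"
      using s(1) q by (auto simp: \<epsilon>_def less_max_iff_disj)
    ultimately show ?thesis by blast
  qed
  show ?thesis
  proof (cases "prob {..<a} = 1")
    case False
    then have "prob {..<a} < 1"
      using prob_le_1 by (simp add: less_le)
    moreover have "a \<le> T z" if "prob {..<a} < z" "z \<le> 1" for z
    proof (rule ccontr)
      assume "\<not> a \<le> T z"
      then have "prob {..T z} \<le> prob {..<a}"
        by (intro finite_measure_mono) auto
      then show False
        using cdf_quantile_ge[of z] that by (simp add: delay_cdf_def)
    qed
    ultimately show ?thesis
      using main[of "prob {..<a}" a] a K' by simp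
  next
    case True
    obtain u where u: "\<And>n. 0 < ereal (u n)" "\<And>n. ereal (u n) < a" "incseq u"
      "(\<lambda>n. ereal (u n)) \<longlonglongrightarrow> a"
      using ereal_incseq_approx[OF a] by metis
    have "(\<lambda>n. partial_mean (u n) + ereal q * u n) \<longlonglongrightarrow> partial_mean a + ereal q * a"
      using a q_bounds partial_mean_nonneg[of a] partial_mean_tendsto[OF u(2-4) True]
      by (intro tendsto_add_ereal_nonneg tendsto_cmult_ereal u) (auto simp: ereal_mult_eq_MInfty)
    then have "\<forall>\<^sub>F n in sequentially. ereal K < partial_mean (u n) + ereal q * u n"
      using K' by (rule order_tendstoD)
    then obtain n where n: "ereal K < partial_mean (u n) + ereal q * u n"
      using eventually_happens'[OF sequentially_bot] by blast
    \<comment> \<open>As \<open>u n\<close> lies below \<open>T 1\<close>, level 1 is not reached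
      there; this leaves a range of levels whose quantiles exceed \<open>u n\<close>.\<close>
    have "P (u n) < 1"
    proof (rule ccontr)
      assume "\<not> P (u n) < 1"
      then have "T 1 \<le> u n"
        unfolding delay_quantile_def by (intro Inf_lower) auto
      then show False
        using u(2)[of n] by (simp add: a_def)
    qed
    moreover have "u n \<le> T z" if "P (u n) < z" "z \<le> 1" for z
      using quantile_gt that by (simp add: less_imp_le)
    ultimately show ?thesis
      using main[of "P (u n)" "u n"] u(1)[of n] n by simp
  qed
qed

section \<open>The convex envelope\<close>

abbreviation (input) minorants :: "(real \<Rightarrow> real) set" where
  "minorants \<equiv> {s. convex_on {0..1 - q} s \<and> s 0 = 0 \<and> (\<forall>x\<in>{0<..1 - q}. ereal (s x) \<le> static_cost M x)}"

lemma opt_cost_ge_minorant: "s \<in> minorants \<Longrightarrow> ereal (s r) \<le> opt_cost M r"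
  unfolding opt_cost_def by (rule SUP_upper)

lemma zero_minorant: "(\<lambda>_. 0) \<in> minorants"
  using static_cost_nonneg by (auto simp: convex_on_def zero_ereal_def[symmetric])

lemma opt_cost_nonneg: "0 \<le> opt_cost M r"
  using opt_cost_ge_minorant[OF zero_minorant] by (simp add: zero_ereal_def)

lemma opt_cost_0: "opt_cost M 0 = 0"
proof (rule antisym)
  show "opt_cost M 0 \<le> 0"
    unfolding opt_cost_def by (intro SUP_least) auto
qed (rule opt_cost_nonneg)

lemma opt_cost_le_static: "0 < r \<Longrightarrow> r \<le> 1 - q \<Longrightarrow> opt_cost M r \<le> static_cost M r"
  unfolding opt_cost_def by (intro SUP_least) auto

text \<open>The hinge that is 0 up to \<epsilon> and rises to \<open>K\<close> at
  \<open>1 - q\<close> stays below the static cost: on the left by nonnegativity, on the right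
  because it never exceeds \<open>K\<close>. The bound is its affine branch.\<close>

lemma opt_cost_ge_hinge:
  assumes "0 \<le> K" "0 \<le> \<epsilon>" "\<epsilon> < 1 - q"
    and K: "\<forall>r. \<epsilon> < r \<longrightarrow> r \<le> 1 - q \<longrightarrow> ereal K \<le> static_cost M r"
  shows "ereal (K * (r - \<epsilon>) / (1 - q - \<epsilon>)) \<le> opt_cost M r"
proof -
  define c where "c = K / (1 - q - \<epsilon>)"
  have c: "0 \<le> c" "c * (1 - q - \<epsilon>) = K"
    using assms by (auto simp: c_def)
  have "(\<lambda>x. max 0 (c * (x - \<epsilon>))) \<in> minorants"
  proof (intro CollectI conjI ballI)
    show "convex_on {0..1 - q} (\<lambda>x. max 0 (c * (x - \<epsilon>)))"
      using c by (intro convex_on_max_zero_affine) auto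
    show "max 0 (c * (0 - \<epsilon>)) = 0"
      using c assms by (simp add: mult_nonneg_nonneg)
    fix x assume x: "x \<in> {0<..1 - q}"
    show "ereal (max 0 (c * (x - \<epsilon>))) \<le> static_cost M x"
    proof (cases "\<epsilon> < x")
      case True
      have "c * (x - \<epsilon>) \<le> K"
        unfolding c(2)[symmetric] using x c(1) by (intro mult_left_mono) auto
      then have "ereal (max 0 (c * (x - \<epsilon>))) \<le> ereal K"
        using assms(1) by simp
      also have "\<dots> \<le> static_cost M x"
        using K True x by auto
      finally show ?thesis .
    next
      case False
      then have "c * (x - \<epsilon>) \<le> 0"
        using c by (simp add: mult_nonneg_nonpos)
      then show ?thesis
        using static_cost_nonneg[of x] x by (simp add: max_absorb1 zero_ereal_def[symmetric])
    qed
  qed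
  from opt_cost_ge_minorant[OF this, of r] show ?thesis
    by (auto simp: c_def elim: order_trans[rotated])
qed

lemma opt_cost_pos:
  assumes "0 < r" "r \<le> 1 - q"
  shows "0 < opt_cost M r"
proof -
  \<comment> \<open>The hinge breaks at \<open>r / 2\<close>, so it is already positive at
    \<open>r\<close>.\<close>
  obtain K where K: "0 < K" "\<forall>x. r / 2 < x \<longrightarrow> x \<le> 1 - q \<longrightarrow> ereal K \<le> static_cost M x"
    using static_cost_bounded_below[of "r / 2"] assms by auto
  have "0 < ereal (K * (r - r / 2) / (1 - q - r / 2))"
    using K assms by simp
  also have "\<dots> \<le> opt_cost M r"
    using opt_cost_ge_hinge[of K "r / 2" r] K assms by simp
  finally show ?thesis .
qed

sublocale convex_cost "opt_cost M" "1 - q"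
proof
  show "0 \<le> 1 - q"
    using q_bounds by simp
  show "opt_cost M 0 = 0"
    by (rule opt_cost_0)
  show "0 \<le> opt_cost M x" for x
    by (rule opt_cost_nonneg)
  show "opt_cost M x < \<infinity>" if "0 \<le> x" "x < 1 - q" for x
    using that opt_cost_0 le_less_trans[OF opt_cost_le_static static_cost_less_infinity]
    by (cases "x = 0") auto
  show "opt_cost M ((1 - t) * x + t * y) \<le> ereal (1 - t) * opt_cost M x + ereal t * opt_cost M y"
    if "0 \<le> x" "x \<le> 1 - q" "0 \<le> y" "y \<le> 1 - q" "0 \<le> t" "t \<le> 1" for x y t
    unfolding opt_cost_def[of M "(1 - t) * x + t * y"]
  proof (rule SUP_least)
    fix s assume s: "s \<in> minorants"
    then have "s ((1 - t) * x + t * y) \<le> (1 - t) * s x + t * s y"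
      using convex_onD[of "{0..1 - q}" s t x y] that by simp
    then have "ereal (s ((1 - t) * x + t * y)) \<le> ereal (1 - t) * ereal (s x) + ereal t * ereal (s y)"
      by simp
    also have "\<dots> \<le> ereal (1 - t) * opt_cost M x + ereal t * opt_cost M y"
      using that by (intro add_mono ereal_mult_left_mono opt_cost_ge_minorant s) auto
    finally show "ereal (s ((1 - t) * x + t * y)) \<le>
      ereal (1 - t) * opt_cost M x + ereal t * opt_cost M y" .
  qed
  show "\<forall>\<^sub>F y in at_left (1 - q). ereal K < opt_cost M y"
    if q: "0 < 1 - q" and K: "ereal K < opt_cost M (1 - q)" for K
  proof -
    show ?thesis
    proof (cases "0 \<le> K")
      case False
      then show ?thesis
        using opt_cost_nonneg less_le_trans[of "ereal K" 0] by (intro always_eventually allI) simp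
    next
      case True
      have "ereal K < static_cost M (1 - q)"
        using K opt_cost_le_static[of "1 - q"] q by simp
      \<comment> \<open>A hinge of height \<open>K'\<close> at the endpoint leaves room: by
        continuity it still exceeds \<open>K\<close> slightly to the left.\<close>
      then obtain K' where K': "K < K'" "ereal K' < static_cost M (1 - q)"
        using ereal_dense2[of "ereal K" "static_cost M (1 - q)"] by auto
      obtain \<epsilon> where \<epsilon>: "0 < \<epsilon>" "\<epsilon> < 1 - q"
        "\<forall>r. \<epsilon> < r \<longrightarrow> r \<le> 1 - q \<longrightarrow> ereal K' \<le> static_cost M r"
        using static_cost_lsc_end[OF _ K'(2)] q by auto
      have "((\<lambda>y. K' * (y - \<epsilon>) / (1 - q - \<epsilon>)) \<longlongrightarrow> K' * (1 - q - \<epsilon>) / (1 - q - \<epsilon>))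
          (at_left (1 - q))"
        by (intro tendsto_intros) (use \<epsilon> in auto)
      then have "\<forall>\<^sub>F y in at_left (1 - q). K < K' * (y - \<epsilon>) / (1 - q - \<epsilon>)"
        using K' \<epsilon> by (intro order_tendstoD(1)) auto
      then show ?thesis
      proof eventually_elim
        case (elim y)
        then have "ereal K < ereal (K' * (y - \<epsilon>) / (1 - q - \<epsilon>))" by simp
        also have "\<dots> \<le> opt_cost M y"
          using \<epsilon> K' True by (intro opt_cost_ge_hinge) auto
        finally show ?case .
      qed
    qed
  qed
qed

text \<open>The bound on the left derivative at \<open>1 - q\<close> is the slope condition at the
  right endpoint, so both cases become one inequality.\<close>

lemma rate_at_iff_subgradient: "rate_at M \<beta> x \<longleftrightarrow> subgradient (opt_cost M) (1 - q) x \<beta>"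
  unfolding has_slope_iff_subgradient[symmetric] rate_at_def
  using q_bounds by (auto simp: has_slope_def)

end

section \<open>Optimal rates\<close>

text \<open>Positivity of \<beta> is conditional because at \<open>\<rho> = 0\<close> a class of
  positive weight with \<open>q < 1\<close> and right derivative 0 at rate 0 admits no positive
  slope there. Necessity is restricted to positive weights because a class of weight 0 does not
  affect optimality.\<close>

theorem theorem4:
  fixes N :: nat and \<pi> :: "nat \<Rightarrow> real" and M :: "nat \<Rightarrow> ereal measure" and \<rho> :: real
  assumes "\<And>i. i \<in> {1..N} \<Longrightarrow> 0 \<le> \<pi> i"
    and "(\<Sum>i=1..N. \<pi> i) = 1"
    and "\<And>i. i \<in> {1..N} \<Longrightarrow> delay_distribution (M i)"
    and "0 \<le> \<rho>"
    and "\<rho> < (\<Sum>i=1..N. \<pi> i * (1 - never_prob (M i)))"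
  shows "(\<exists>\<beta> r. 0 \<le> \<beta> \<and>
            (0 < \<rho> \<or> (\<forall>i\<in>{1..N}. never_prob (M i) < 1 \<longrightarrow> 0 < right_deriv (opt_cost (M i)) 0)
               \<longrightarrow> 0 < \<beta>) \<and>
            (\<forall>i\<in>{1..N}. rate_at (M i) \<beta> (r i)) \<and> (\<Sum>i=1..N. \<pi> i * r i) = \<rho>) \<and>
         (\<forall>\<beta> r. 0 \<le> \<beta> \<and> (\<forall>i\<in>{1..N}. rate_at (M i) \<beta> (r i)) \<and> (\<Sum>i=1..N. \<pi> i * r i) = \<rho> \<longrightarrow>
            optimal_rates N \<pi> M \<rho> r \<and>
            (\<forall>r'. optimal_rates N \<pi> M \<rho> r' \<longrightarrow>
               (\<forall>i\<in>{1..N}. 0 < \<pi> i \<longrightarrow> rate_at (M i) \<beta> (r' i))))"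
proof (intro conjI allI impI)
  define f where "f i = opt_cost (M i)" for i
  define b where "b i = 1 - never_prob (M i)" for i
  have delay: "request_delay (M i)" if "i \<in> {1..N}" for i
    using assms(3)[OF that]
    by (auto simp: request_delay_def request_delay_axioms_def delay_distribution_def)
  have cost: "convex_cost (f i) (b i)" if "i \<in> {1..N}" for i
  proof -
    interpret request_delay "M i" by (rule delay[OF that])
    show ?thesis
      unfolding f_def b_def by (rule convex_cost_axioms)
  qed
  have rate: "rate_at (M i) \<beta> x \<longleftrightarrow> subgradient (f i) (b i) x \<beta>" if "i \<in> {1..N}" for i \<beta> x
    unfolding f_def b_def by (rule request_delay.rate_at_iff_subgradient[OF delay[OF that]])
  show "\<exists>\<beta> r. 0 \<le> \<beta> \<and>
      (0 < \<rho> \<or> (\<forall>i\<in>{1..N}. never_prob (M i) < 1 \<longrightarrow> 0 < right_deriv (opt_cost (M i)) 0)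
         \<longrightarrow> 0 < \<beta>) \<and>
      (\<forall>i\<in>{1..N}. rate_at (M i) \<beta> (r i)) \<and> (\<Sum>i=1..N. \<pi> i * r i) = \<rho>"
  proof (cases "\<rho> = 0 \<and> (\<forall>i\<in>{1..N}. never_prob (M i) < 1 \<longrightarrow> 0 < right_deriv (opt_cost (M i)) 0)")
    case True
    \<comment> \<open>With all rates 0, the slope is bounded only by right derivatives at 0. These
      are positive and finitely many, so every small positive \<beta> works.\<close>
    have "\<forall>\<^sub>F \<beta> in at_right 0. rate_at (M i) \<beta> 0" if i: "i \<in> {1..N}" for i
    proof -
      have "\<forall>\<^sub>F \<beta> in at_right 0. never_prob (M i) < 1 \<longrightarrow> ereal \<beta> \<le> right_deriv (f i) 0"
      proof (cases "never_prob (M i) < 1")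
        case q: True
        have "((\<lambda>\<beta>. ereal \<beta>) \<longlongrightarrow> ereal 0) (at_right 0)"
          by (intro tendsto_intros)
        then have "\<forall>\<^sub>F \<beta> in at_right 0. ereal \<beta> < right_deriv (f i) 0"
          using True q i by (intro order_tendstoD(2)) (auto simp: f_def zero_ereal_def)
        then show ?thesis
          by (auto elim!: eventually_mono intro: less_imp_le)
      qed simp
      then show ?thesis
        by eventually_elim (use convex_cost.b_nonneg[OF cost[OF i]] in
          \<open>auto simp: rate_at_def has_slope_def f_def b_def\<close>)
    qed
    then have "\<forall>\<^sub>F \<beta> in at_right 0. 0 < \<beta> \<and> (\<forall>i\<in>{1..N}. rate_at (M i) \<beta> 0)"
      by (intro eventually_conj eventually_ball_finite eventually_at_right_less) auto
    then obtain \<beta> where "0 < \<beta>" "\<forall>i\<in>{1..N}. rate_at (M i) \<beta> 0"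
      using eventually_happens trivial_limit_at_right_real by blast
    then show ?thesis
      using True by (intro exI[of _ \<beta>] exI[of _ "\<lambda>_. 0"]) auto
  next
    case False
    obtain \<beta> r where \<beta>: "0 \<le> \<beta>" and r: "\<And>i. i \<in> {1..N} \<Longrightarrow> subgradient (f i) (b i) (r i) \<beta>"
      "(\<Sum>i=1..N. \<pi> i * r i) = \<rho>"
      using multiplier_exists[of "{1..N}" \<pi> f b \<rho>, OF _ assms(1) cost assms(4)] assms(5)
      unfolding b_def by blast
    \<comment> \<open>In this case the premise for positivity amounts to \<open>0 < \<rho>\<close>.
      A zero slope would make each \<open>r i\<close> a minimizer of its cost, hence 0 because the
      cost is positive elsewhere.\<close>
    have "0 < \<beta>" if "0 < \<rho>"
    proof (rule ccontr)
      assume "\<not> 0 < \<beta>"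
      then have "\<beta> = 0" using \<beta> by simp
      have "r i = 0" if i: "i \<in> {1..N}" for i
      proof (rule ccontr)
        assume "r i \<noteq> 0"
        have ri: "0 \<le> r i" "r i \<le> b i" "f i (r i) \<le> f i 0"
          using r(1)[OF i] \<open>\<beta> = 0\<close> by (auto simp: subgradient_def)
        moreover have "0 < f i (r i)"
          using request_delay.opt_cost_pos[OF delay[OF i], of "r i"] ri \<open>r i \<noteq> 0\<close>
          by (simp add: f_def b_def)
        ultimately show False
          using convex_cost.zero[OF cost[OF i]] by simp
      qed
      then have "(\<Sum>i=1..N. \<pi> i * r i) = 0"
        by simp
      then show False
        using r(2) that by simp
    qed
    then show ?thesis
      using \<beta> r assms(4) False by (intro exI[of _ \<beta>] exI[of _ r]) (auto simp: rate)
  qed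
  fix \<beta> r
  assume *: "0 \<le> \<beta> \<and> (\<forall>i\<in>{1..N}. rate_at (M i) \<beta> (r i)) \<and> (\<Sum>i=1..N. \<pi> i * r i) = \<rho>"
  then have sub: "\<And>i. i \<in> {1..N} \<Longrightarrow> subgradient (f i) (b i) (r i) \<beta>"
    and sum: "(\<Sum>i=1..N. \<pi> i * r i) = \<rho>"
    by (auto simp: rate)
  have feas: "feasible N \<pi> M \<rho> r"
    using sub sum by (auto simp: feasible_def subgradient_def b_def)
  note min = subgradient_minimizes[of "{1..N}" \<pi> f b r \<beta>, OF _ assms(1) cost sub]
  have le: "storage_cost N \<pi> M r \<le> storage_cost N \<pi> M r'" if "feasible N \<pi> M \<rho> r'" for r'
    using min(1)[of r'] that sum by (auto simp: feasible_def storage_cost_def f_def b_def)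
  show "optimal_rates N \<pi> M \<rho> r"
    using feas le by (auto simp: optimal_rates_def is_arg_min_def not_less)
  show "\<forall>i\<in>{1..N}. 0 < \<pi> i \<longrightarrow> rate_at (M i) \<beta> (r' i)" if "optimal_rates N \<pi> M \<rho> r'" for r'
  proof -
    have "feasible N \<pi> M \<rho> r'" "storage_cost N \<pi> M r' \<le> storage_cost N \<pi> M r"
      using that feas by (auto simp: optimal_rates_def is_arg_min_def not_less)
    then show ?thesis
      using min(2)[of r'] sum rate by (auto simp: feasible_def storage_cost_def f_def b_def)
  qed
qed

end
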